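(* Let $(\mathbb{P};\mathcal{F},\Delta)$ be a discrete-time one-dimensional noise on a probability space $(\Omega,\mathcal{G},\mathbb{P})$, symmetric under a time-reversal $\mathsf{r}$, and let $\tau=(\tau_n)_{n\in\mathbb{N}_0}$ be a sequence of random times such that, for every $n\in\mathbb{N}_0$, $\tau_n$ takes values in $\{0,1,\ldots,n\}$ and is $\mathcal{F}_n$-measurable. Then the following two statements are equivalent. (a) The family $\tau$ is symmetric splitting for $(\mathbb{P};\mathcal{F},\Delta,\mathsf{r})$. (b) For all $m,n\in\mathbb{N}_0$, $\mathbb{P}$-almost surely, $$\{\tau_{m+n}=m\}=(\mathsf{r}\circ\Delta_m)^{-1}(\{\tau_m=0\})\cap\Delta_m^{-1}(\{\tau_n=0\}).$$ In particular, if $\tau$ is symmetric splitting for $(\mathbb{P};\mathcal{F},\Delta,\mathsf{r})$, then $$\tau_n+\tau_n\circ(\mathsf{r}\circ\Delta_n)=n\quad \mathbb{P}\text{-a.s. for all } n\in\mathbb{N}_0.$$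
   Context: Noise symmetric under time-reversal. $(\Omega,\mathcal{G},\mathbb{P})$ is a probability space; $\mathcal{F}=(\mathcal{F}_{m,n})_{(m,n)\in\mathbb{Z}^2,\,m\le n}$ is a family of sub-$\sigma$-fields of $\mathcal{G}$, each $\mathbb{P}$-complete in the sense that it contains $\mathbb{P}^{-1}(\{0,1\})$, i.e. every event of $\mathcal{G}$ having probability $0$ or $1$; $\Delta=(\Delta_h)_{h\in\mathbb{Z}}$ is a $\mathbb{Z}$-indexed group of transformations of $\Omega$ ($\Delta_0=\mathrm{id}_\Omega$, $\Delta_{h+k}=\Delta_h\circ\Delta_k$), each $\mathcal{G}/\mathcal{G}$-measurable and preserving $\mathbb{P}$. $(\mathbb{P};\mathcal{F},\Delta)$ is a (discrete-time one-dimensional) noise if: (i) $\bigvee_{n\in\mathbb{N}_0}\mathcal{F}_{-n,n}=\mathcal{G}$; (ii) $\Delta_h^{-1}\mathcal{F}_{m,n}=\mathcal{F}_{m+h,n+h}$ for all integers $m\le n$ and $h$; (iii) for all integers $l\le m\le n$, $\mathcal{F}_{l,m}$ and $\mathcal{F}_{m,n}$ are independent and $\mathcal{F}_{l,m}\vee\mathcal{F}_{m,n}=\mathcal{F}_{l,n}$. It is symmetric under the time-reversal $\mathsf{r}$ if $\mathsf{r}:\Omega\to\Omega$ is an involution ($\mathsf{r}\circ\mathsf{r}=\mathrm{id}_\Omega$), $\mathcal{G}/\mathcal{G}$-measurable, preserving $\mathbb{P}$, and such that: (iv) $\mathsf{r}\circ\Delta_h=\Delta_{-h}\circ\mathsf{r}$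 for all integers $h$; (v) $\mathsf{r}^{-1}\mathcal{F}_{m,n}=\mathcal{F}_{-n,-m}$ for all integers $m\le n$. Write $\mathcal{F}_n:=\mathcal{F}_{0,n}$ for $n\in\mathbb{N}_0$ and $\mathcal{F}_\infty:=\bigvee_{n\in\mathbb{N}_0}\mathcal{F}_{0,n}$. Symmetric splitting. For $p\in(0,1)$, let (on an enlargement of the probability space, e.g. the product of $\Omega$ with $\mathbb{N}_0$) $\mathsf{g}_p$ be a random time independent of $\mathcal{G}$ with $\mathbb{P}(\mathsf{g}_p=k)=p(1-p)^k$, $k\in\mathbb{N}_0$. A family $\tau=(\tau_n)_{n\in\mathbb{N}_0}$, with $\tau_n$ being $\{0,\ldots,n\}$-valued and $\mathcal{F}_n$-measurable for each $n$, is symmetric splitting for $(\mathbb{P};\mathcal{F},\Delta,\mathsf{r})$ if, for all $p\in(0,1)$, the pairs $(\mathsf{r}\circ\Delta_{\tau_{\mathsf{g}_p}},\tau_{\mathsf{g}_p})$ and $(\Delta_{\tau_{\mathsf{g}_p}},\mathsf{g}_p-\tau_{\mathsf{g}_p})$, viewed as random elements of $(\Omega\times\mathbb{N}_0,\mathcal{F}_\infty\otimes 2^{\mathbb{N}_0})$, are independent and have the same distribution. Here $\tau_{\mathsf{g}_p}$ is $\tau_n$ on $\{\mathsf{g}_p=n\}$, and $\Delta_{\tau_{\mathsf{g}_p}}$ is $\Delta_m$ on $\{\tau_{\mathsf{g}_p}=m\}$. Equality of events $\mathbb{P}$-a.s. means that their symmetric difference is $\mathbb{P}$-null. *)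

theory Defs
  imports "HOL-Probability.Probability"
begin

text \<open>
  The sample space is \<open>space M\<close>, so transformations are total functions on the type whose
  defining identities are only required on \<open>space M\<close>. The \<open>\<sigma>\<close>-fields are sets of subsets of
  \<open>space M\<close>; only the values \<open>F m n\<close> with \<open>m \<le> n\<close> are constrained. The measure \<open>M\<close> need not be
  complete: completeness of \<open>F m n\<close> is relative to \<open>sets M\<close>.
\<close>

definition preserves :: "'a measure \<Rightarrow> ('a \<Rightarrow> 'a) \<Rightarrow> bool" where
  "preserves M f \<longleftrightarrow> f \<in> measurable M M \<and> distr M M f = M"

definition preimage_field :: "'a measure \<Rightarrow> ('a \<Rightarrow> 'a) \<Rightarrow> 'a set set \<Rightarrow> 'a set set" where
  "preimage_field M f \<A> = (\<lambda>A. f -` A \<inter> space M) ` \<A>"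

locale noise = prob_space M for M :: "'a measure" +
  fixes F :: "int \<Rightarrow> int \<Rightarrow> 'a set set"
    and \<Delta> :: "int \<Rightarrow> 'a \<Rightarrow> 'a"
  assumes field_sigma_algebra: "m \<le> n \<Longrightarrow> sigma_algebra (space M) (F m n)"
    and field_sub: "m \<le> n \<Longrightarrow> F m n \<subseteq> sets M"
    and field_complete: "m \<le> n \<Longrightarrow> {A \<in> sets M. prob A = 0 \<or> prob A = 1} \<subseteq> F m n"
    and shift_zero: "\<omega> \<in> space M \<Longrightarrow> \<Delta> 0 \<omega> = \<omega>"
    and shift_add: "\<omega> \<in> space M \<Longrightarrow> \<Delta> (h + k) \<omega> = \<Delta> h (\<Delta> k \<omega>)"
    and shift_preserves: "preserves M (\<Delta> h)"
    and generates: "sigma_sets (space M) (\<Union>n::nat. F (- int n) (int n)) = sets M"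
    and field_shift: "m \<le> n \<Longrightarrow> preimage_field M (\<Delta> h) (F m n) = F (m + h) (n + h)"
    and field_indep: "l \<le> m \<Longrightarrow> m \<le> n \<Longrightarrow> indep_set (F l m) (F m n)"
    and field_join: "l \<le> m \<Longrightarrow> m \<le> n \<Longrightarrow> sigma_sets (space M) (F l m \<union> F m n) = F l n"

locale symmetric_noise = noise M F \<Delta>
  for M :: "'a measure" and F :: "int \<Rightarrow> int \<Rightarrow> 'a set set" and \<Delta> :: "int \<Rightarrow> 'a \<Rightarrow> 'a" +
  fixes r :: "'a \<Rightarrow> 'a"
  assumes reversal_involution: "\<omega> \<in> space M \<Longrightarrow> r (r \<omega>) = \<omega>"
    and reversal_preserves: "preserves M r"
    and reversal_shift: "\<omega> \<in> space M \<Longrightarrow> r (\<Delta> h \<omega>) = \<Delta> (- h) (r \<omega>)"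
    and reversal_field: "m \<le> n \<Longrightarrow> preimage_field M r (F m n) = F (- n) (- m)"

text \<open>The measurable spaces \<open>(\<Omega>, F\<^sub>n)\<close> and \<open>(\<Omega>, F\<^sub>\<infinity>)\<close>; the measure part of these is irrelevant.\<close>

definition field_space :: "'a measure \<Rightarrow> (int \<Rightarrow> int \<Rightarrow> 'a set set) \<Rightarrow> nat \<Rightarrow> 'a measure" where
  "field_space M F n = sigma (space M) (F 0 (int n))"

definition field_space_inf :: "'a measure \<Rightarrow> (int \<Rightarrow> int \<Rightarrow> 'a set set) \<Rightarrow> 'a measure" where
  "field_space_inf M F = sigma (space M) (\<Union>n::nat. F 0 (int n))"

text \<open>
  The enlargement of \<open>M\<close> carrying an independent geometric time: a point is a pair \<open>(\<omega>, k)\<close>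
  and \<open>g\<^sub>p\<close> is the second coordinate, so that \<open>\<tau>\<close> at time \<open>g\<^sub>p\<close> has the value \<open>\<tau> k \<omega>\<close>.
  In \<open>post_split\<close> the subtraction on \<open>nat\<close> is exact, because \<open>\<tau> k \<omega> \<le> k\<close>
  for the families considered.
\<close>

definition geometric_enlargement :: "'a measure \<Rightarrow> real \<Rightarrow> ('a \<times> nat) measure" where
  "geometric_enlargement M p = M \<Otimes>\<^sub>M measure_pmf (geometric_pmf p)"

definition pre_split ::
  "(int \<Rightarrow> 'a \<Rightarrow> 'a) \<Rightarrow> ('a \<Rightarrow> 'a) \<Rightarrow> (nat \<Rightarrow> 'a \<Rightarrow> nat) \<Rightarrow> 'a \<times> nat \<Rightarrow> 'a \<times> nat" where
  "pre_split \<Delta> r \<tau> = (\<lambda>(\<omega>, k). (r (\<Delta> (int (\<tau> k \<omega>)) \<omega>), \<tau> k \<omega>))"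

definition post_split ::
  "(int \<Rightarrow> 'a \<Rightarrow> 'a) \<Rightarrow> (nat \<Rightarrow> 'a \<Rightarrow> nat) \<Rightarrow> 'a \<times> nat \<Rightarrow> 'a \<times> nat" where
  "post_split \<Delta> \<tau> = (\<lambda>(\<omega>, k). (\<Delta> (int (\<tau> k \<omega>)) \<omega>, k - \<tau> k \<omega>))"

definition symmetric_splitting ::
  "'a measure \<Rightarrow> (int \<Rightarrow> int \<Rightarrow> 'a set set) \<Rightarrow> (int \<Rightarrow> 'a \<Rightarrow> 'a) \<Rightarrow> ('a \<Rightarrow> 'a) \<Rightarrow>
    (nat \<Rightarrow> 'a \<Rightarrow> nat) \<Rightarrow> bool" where
  "symmetric_splitting M F \<Delta> r \<tau> \<longleftrightarrow>
    (\<forall>p\<in>{0<..<1}.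
      let P = geometric_enlargement M p;
          S = field_space_inf M F \<Otimes>\<^sub>M count_space UNIV
      in prob_space.indep_var P S (pre_split \<Delta> r \<tau>) S (post_split \<Delta> \<tau>) \<and>
         distr P S (pre_split \<Delta> r \<tau>) = distr P S (post_split \<Delta> \<tau>))"

definition events_eq_as :: "'a measure \<Rightarrow> 'a set \<Rightarrow> 'a set \<Rightarrow> bool" where
  "events_eq_as M A B \<longleftrightarrow> (A - B) \<union> (B - A) \<in> null_sets M"

end

theory Submission
  imports Defs
begin

text \<open>
  On the event that \<open>\<tau>\<close> at the geometric time equals \<open>m\<close> and the remaining time equals \<open>n\<close>, the
  two parts of the path are \<open>r \<circ> \<Delta> m\<close> and \<open>\<Delta> m\<close>. Hence symmetric splitting says exactly that
  \<open>p (1 - p)\<^sup>m\<^sup>+\<^sup>n P(r \<circ> \<Delta> m \<in> A, \<Delta> m \<in> B, \<tau> (m + n) = m)\<close> factorises as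
  \<open>f A m \<cdot> f B n\<close>, and the case \<open>m = 0\<close>, where \<open>{\<tau> 0 = 0}\<close> is everything, forces
  \<open>f A m = sqrt p (1 - p)\<^sup>m P(A \<inter> {\<tau> m = 0})\<close>. Past and future being independent, this states
  that \<open>{\<tau> (m + n) = m}\<close> and the event on the right of (b) have intersections of equal
  probability with all events \<open>{r \<circ> \<Delta> m \<in> A, \<Delta> m \<in> B}\<close>. These generate \<open>F 0 (m + n)\<close>, which
  contains both events, so they agree up to a null set.
\<close>

section \<open>Products with a countable discrete factor\<close>

text \<open>A rectangle \<open>a \<times> b\<close> is a countable union of slices: index
  \<open>i\<close> contributes \<open>a \<times> {from_nat i}\<close>, or the empty slice if
  \<open>from_nat i\<close> lies outside \<open>b\<close>. Laws of pairs consisting of a point and a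
  time can thus be tested at one time value.\<close>

lemma sets_pair_count_space:
  fixes N :: "'a measure"
  shows "sets (N \<Otimes>\<^sub>M count_space (UNIV :: 'b :: countable set)) =
    sigma_sets (space N \<times> UNIV) {A \<times> {m} | A m. A \<in> sets N}"
proof -
  let ?G = "{A \<times> {m :: 'b} | A m. A \<in> sets N}"
  have "a \<times> b \<in> sigma_sets (space N \<times> UNIV) ?G" if "a \<in> sets N" for a and b :: "'b set"
  proof -
    have "a \<times> b = (\<Union>i. (if from_nat i \<in> b then a else {}) \<times> {from_nat i})"
      by (auto split: if_splits intro: exI[of _ "to_nat _"]) (metis from_nat_to_nat)
    also have "\<dots> \<in> sigma_sets (space N \<times> UNIV) ?G"
      using that by (intro sigma_sets.Union sigma_sets.Basic) auto
    finally show ?thesis .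
  qed
  then show ?thesis
    unfolding sets_pair_measure space_count_space by (intro sigma_sets_eqI) auto
qed

lemma Int_stable_pair_singleton: "Int_stable {A \<times> {m} | A m. A \<in> sets N}"
proof (rule Int_stableI, clarify)
  fix A B m n assume "A \<in> sets N" "B \<in> sets N"
  then show "\<exists>C k. (A \<times> {m}) \<inter> (B \<times> {n}) = C \<times> {k} \<and> C \<in> sets N"
    \<comment> \<open>For \<open>m \<noteq> n\<close> the slices are disjoint, and the empty set is
      written as \<open>{} \<times> {m}\<close>.\<close>
    by (intro exI[of _ "if m = n then A \<inter> B else {}"] exI[of _ m]) auto
qed

section \<open>Generators, independence and equality of laws\<close>

context prob_space
begin

text \<open>The sets \<open>C\<close> whose intersections with \<open>A\<close> and \<open>B\<close>
  are equally probable form a Dynkin system, so the equality spreads from \<open>G\<close> to the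
  generated sigma-field, to which \<open>A\<close> and \<open>B\<close> themselves belong. The test
  set \<open>space M\<close> supplies \<open>prob A = prob B\<close> for complements.\<close>

lemma symdiff_null_sets_if_generator:
  assumes G: "G \<subseteq> events" "Int_stable G"
    and A: "A \<in> sigma_sets (space M) G" and B: "B \<in> sigma_sets (space M) G"
    and eq: "\<And>C. C \<in> insert (space M) G \<Longrightarrow> prob (A \<inter> C) = prob (B \<inter> C)"
  shows "(A - B) \<union> (B - A) \<in> null_sets M"
proof -
  have events: "sigma_sets (space M) G \<subseteq> events"
    using G(1) by (rule sets.sigma_sets_subset)
  have [measurable]: "A \<in> events" "B \<in> events"
    using A B events by auto
  have G': "G \<subseteq> Pow (space M)"
    using G(1) sets.space_closed by auto
  have *: "prob (A \<inter> C) = prob (B \<inter> C)" if "C \<in> sigma_sets (space M) G" for C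
    using G(2) G' that
  proof (induction rule: sigma_sets_induct_disjoint)
    case (basic C)
    then show ?case using eq by auto
  next
    case empty
    then show ?case by simp
  next
    case (compl C)
    then have [measurable]: "C \<in> events" using events by auto
    have "prob (D \<inter> (space M - C)) = prob D - prob (D \<inter> C)"
      if [measurable]: "D \<in> events" for D
    proof -
      have "D \<inter> (space M - C) = D - D \<inter> C"
        using sets.sets_into_space[OF that] by blast
      then show ?thesis by (simp add: finite_measure_Diff)
    qed
    then have "prob (A \<inter> (space M - C)) = prob A - prob (A \<inter> C)"
      "prob (B \<inter> (space M - C)) = prob B - prob (B \<inter> C)"
      by (simp_all only: \<open>A \<in> events\<close> \<open>B \<in> events\<close>)
    moreover have "prob A = prob B"
      using eq[of "space M"] by simp
    ultimately show ?case using compl.IH by simp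
  next
    case (union C)
    then have "range C \<subseteq> events" using events by auto
    have "(\<lambda>i. prob (D \<inter> C i)) sums prob (D \<inter> (\<Union>i. C i))" if "D \<in> events" for D
    proof -
      have "(\<lambda>i. prob (D \<inter> C i)) sums prob (\<Union>i. D \<inter> C i)"
        using that \<open>range C \<subseteq> events\<close> union(1)
        by (intro finite_measure_UNION) (auto simp: disjoint_family_on_def)
      then show ?thesis by simp
    qed
    then have "(\<lambda>i. prob (A \<inter> C i)) sums prob (A \<inter> (\<Union>i. C i))"
      "(\<lambda>i. prob (B \<inter> C i)) sums prob (B \<inter> (\<Union>i. C i))"
      by simp_all
    then show ?case using union.IH by (simp add: sums_unique2)
  qed
  \<comment> \<open>With \<open>C = A\<close> and \<open>C = B\<close> as test sets, both
    \<open>prob A\<close> and \<open>prob B\<close> equal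
    \<open>prob (A \<inter> B)\<close>.\<close>
  have "prob (A - B) = 0" "prob (B - A) = 0"
    using *[OF A] *[OF B] by (simp_all add: finite_measure_Diff' Int_commute)
  then have "A - B \<in> null_sets M" "B - A \<in> null_sets M"
    by (auto simp: null_sets_def emeasure_eq_measure)
  then show ?thesis by (rule null_sets.Un)
qed

text \<open>Preimages of a pi-system form a pi-system, and taking preimages commutes with generating
  a sigma-field, so independence of the generators suffices.\<close>

lemma indep_varI_generator:
  assumes X: "random_variable S X" and Y: "random_variable T Y"
    and S: "sets S = sigma_sets (space S) G" and T: "sets T = sigma_sets (space T) H"
    and G: "Int_stable G" and H: "Int_stable H"
    and eq: "\<And>A B. A \<in> G \<Longrightarrow> B \<in> H \<Longrightarrow>
      prob ((X -` A \<inter> space M) \<inter> (Y -` B \<inter> space M)) =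
      prob (X -` A \<inter> space M) * prob (Y -` B \<inter> space M)"
  shows "indep_var S X T Y"
proof -
  have stable: "Int_stable {Z -` A \<inter> space M | A. A \<in> J}"
    if "Int_stable J" for Z :: "'a \<Rightarrow> 'z" and J
  proof (rule Int_stableI, clarify)
    fix A B assume "A \<in> J" "B \<in> J"
    then have "A \<inter> B \<in> J" using that by (rule Int_stableD[rotated 1])
    then show "\<exists>C. (Z -` A \<inter> space M) \<inter> (Z -` B \<inter> space M) = Z -` C \<inter> space M \<and> C \<in> J"
      by (intro exI[of _ "A \<inter> B"]) auto
  qed
  have "G \<subseteq> sets S" "H \<subseteq> sets T"
    using S T by auto
  then have "indep_set {X -` A \<inter> space M | A. A \<in> G} {Y -` B \<inter> space M | B. B \<in> H}"
    using X Y by (intro indep_setI) (auto simp: eq intro: measurable_sets)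
  then have "indep_set (sigma_sets (space M) {X -` A \<inter> space M | A. A \<in> G})
      (sigma_sets (space M) {Y -` B \<inter> space M | B. B \<in> H})"
    by (intro indep_set_sigma_sets stable G H)
  moreover have generated: "sigma_sets (space M) {Z -` A \<inter> space M | A. A \<in> sets U} =
      sigma_sets (space M) {Z -` A \<inter> space M | A. A \<in> J}"
    if "Z \<in> measurable M U" "sets U = sigma_sets (space U) J"
    for Z :: "'a \<Rightarrow> 'z" and U J
  proof -
    have "Z \<in> space M \<rightarrow> space U"
      using that(1) by (auto dest: measurable_space)
    from sigma_sets_vimage_commute[OF this, of J] show ?thesis
      using sigma_sets_sigma_sets_eq[of "{Z -` A \<inter> space M | A. A \<in> J}" "space M"]
      unfolding that(2) by auto
  qed
  ultimately show ?thesis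
    unfolding indep_var_eq generated[OF X S] generated[OF Y T] using X Y by simp
qed

text \<open>Summing the product formula over all atoms forces \<open>(\<Sum>n. f (space N) n) = 1\<close>, so that
  \<open>f\<close> is automatically the common distribution.\<close>

lemma indep_identically_distributed_iff:
  fixes N :: "'b measure" and X Y :: "'a \<Rightarrow> 'b \<times> nat"
  defines "S \<equiv> N \<Otimes>\<^sub>M count_space UNIV"
  assumes X [measurable]: "random_variable S X" and Y [measurable]: "random_variable S Y"
  shows "indep_var S X S Y \<and> distr M S X = distr M S Y \<longleftrightarrow>
    (\<exists>f. (\<forall>A\<in>sets N. \<forall>m. 0 \<le> f A m) \<and> (\<forall>A\<in>sets N. \<forall>B\<in>sets N. \<forall>m n.
      prob ((X -` (A \<times> {m}) \<inter> space M) \<inter> (Y -` (B \<times> {n}) \<inter> space M)) = f A m * f B n))"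
    (is "_ \<longleftrightarrow> (\<exists>f. ?nonneg f \<and> ?factor f)")
proof
  assume *: "indep_var S X S Y \<and> distr M S X = distr M S Y"
  \<comment> \<open>Since the two laws coincide, the law of \<open>X\<close> also serves as the
    factor belonging to \<open>Y\<close>.\<close>
  define f where "f A m = measure (distr M S X) (A \<times> {m})" for A m
  have "prob ((X -` (A \<times> {m}) \<inter> space M) \<inter> (Y -` (B \<times> {n}) \<inter> space M)) = f A m * f B n"
    if "A \<in> sets N" "B \<in> sets N" for A B m n
  proof -
    have S: "A \<times> {m} \<in> sets S" "B \<times> {n} \<in> sets S"
      using that unfolding S_def by auto
    have "f A m = prob (X -` (A \<times> {m}) \<inter> space M)"
      unfolding f_def using S by (simp add: measure_distr)
    moreover have "f B n = prob (Y -` (B \<times> {n}) \<inter> space M)"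
      unfolding f_def using S * by (simp add: measure_distr)
    moreover have "(X -` (A \<times> {m}) \<inter> space M) \<inter> (Y -` (B \<times> {n}) \<inter> space M) =
        (\<lambda>x. (X x, Y x)) -` ((A \<times> {m}) \<times> (B \<times> {n})) \<inter> space M"
      by auto
    ultimately show ?thesis
      using indep_varD[of S X S Y, OF _ S] * by simp
  qed
  then show "\<exists>f. ?nonneg f \<and> ?factor f"
    by (intro exI[of _ f]) (auto simp: f_def)
next
  assume "\<exists>f. ?nonneg f \<and> ?factor f"
  then obtain f where nonneg: "\<And>A m. A \<in> sets N \<Longrightarrow> 0 \<le> f A m"
    and factor: "\<And>A B m n. A \<in> sets N \<Longrightarrow> B \<in> sets N \<Longrightarrow>
      prob ((X -` (A \<times> {m}) \<inter> space M) \<inter> (Y -` (B \<times> {n}) \<inter> space M)) = f A m * f B n"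
    by metis
  have S: "space S = space N \<times> UNIV" "sets S = sigma_sets (space S) {A \<times> {m} | A m. A \<in> sets N}"
    unfolding S_def by (auto simp: sets_pair_count_space space_pair_measure)
  have meas: "Z -` (A \<times> {m}) \<inter> space M \<in> events"
    if "random_variable S Z" "A \<in> sets N" for Z A and m :: nat
    using that unfolding S_def by (intro measurable_sets[OF that(1)[unfolded S_def]]) auto
  have sums: "(\<lambda>n. prob (E \<inter> (Z -` (space N \<times> {n}) \<inter> space M))) sums prob E"
    if Z: "random_variable S Z" and E: "E \<in> events" for Z :: "'a \<Rightarrow> 'b \<times> nat" and E
  proof -
    have "(\<lambda>n. prob (E \<inter> (Z -` (space N \<times> {n}) \<inter> space M))) sums
        prob (\<Union>n. E \<inter> (Z -` (space N \<times> {n}) \<inter> space M))"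
      using Z E meas[OF Z] by (intro finite_measure_UNION) (auto simp: disjoint_family_on_def)
    also have "(\<Union>n. E \<inter> (Z -` (space N \<times> {n}) \<inter> space M)) = E"
      using sets.sets_into_space[OF E] measurable_space[OF Z]
      by (auto simp: S(1) mem_Times_iff)
    finally show ?thesis .
  qed
  \<comment> \<open>Convergence of this series is established only below; until then
    \<open>K\<close> is a formal \<open>suminf\<close>.\<close>
  define K where "K = (\<Sum>n. f (space N) n)"
  have X_sums: "(\<lambda>n. f A m * f (space N) n) sums prob (X -` (A \<times> {m}) \<inter> space M)"
    if "A \<in> sets N" for A m
    using sums[OF Y meas[OF X that]] that by (simp add: factor)
  have Y_sums: "(\<lambda>n. f (space N) n * f A m) sums prob (Y -` (A \<times> {m}) \<inter> space M)"
    if "A \<in> sets N" for A m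
    using sums[OF X meas[OF Y that]] that by (simp add: factor Int_commute[of "Y -` _ \<inter> _"])
  have total: "(\<lambda>m. prob (X -` (space N \<times> {m}) \<inter> space M)) sums 1"
    using sums[OF X sets.top] by (simp add: prob_space Int_absorb1)
  \<comment> \<open>The masses of the slices add up to 1, so one of them is nonzero. Its factor
    \<open>f (space N) m0\<close> can be divided out of \<open>X_sums\<close>, which makes the
    series for \<open>K\<close> converge.\<close>
  obtain m0 where m0: "prob (X -` (space N \<times> {m0}) \<inter> space M) \<noteq> 0"
    using total sums_unique[OF total] by force
  then have "f (space N) m0 \<noteq> 0"
    using X_sums[of "space N" m0] by (metis (no_types, lifting) mult_zero_left sets.top sums_unique2 sums_zero sums_cong)
  then have K: "(\<lambda>n. f (space N) n) sums K"
    using sums_mult_D[OF X_sums[OF sets.top, of m0]] unfolding K_def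
    by (simp add: sums_iff)
  have X_eq: "prob (X -` (A \<times> {m}) \<inter> space M) = f A m * K" if "A \<in> sets N" for A m
    using X_sums[OF that] sums_mult[OF K] by (rule sums_unique2)
  have Y_eq: "prob (Y -` (A \<times> {m}) \<inter> space M) = f A m * K" if "A \<in> sets N" for A m
    using sums_unique2[OF Y_sums[OF that] sums_mult2[OF K]] by simp
  \<comment> \<open>Both marginals are \<open>K\<close> times \<open>f\<close>, so the total mass of
    \<open>X\<close> is \<open>K * K\<close>. Nonnegativity of \<open>f\<close> excludes
    \<open>K = -1\<close>; the product formula alone does not distinguish \<open>f\<close> from its
    negative.\<close>
  have "K * K = 1"
    using total sums_mult2[OF K, of K] by (simp add: X_eq sums_unique2)
  moreover have "0 \<le> K"
    unfolding K_def using K nonneg by (intro suminf_nonneg) (auto simp: sums_iff)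
  ultimately have "K = 1"
    by (smt (verit) mult_cancel_right1 square_eq_1_iff)
  note X_eq = X_eq[unfolded \<open>K = 1\<close> mult_1_right] and Y_eq = Y_eq[unfolded \<open>K = 1\<close> mult_1_right]
  have "indep_var S X S Y"
    using X_eq Y_eq factor
    by (intro indep_varI_generator[OF X Y S(2) S(2)] Int_stable_pair_singleton) auto
  moreover have "distr M S X = distr M S Y"
  proof (rule measure_eqI_generator_eq[where \<Omega> = "space S" and A = "\<lambda>i. space N \<times> {i}"])
    show "emeasure (distr M S X) Q = emeasure (distr M S Y) Q"
      if Q: "Q \<in> {A \<times> {m} | A m. A \<in> sets N}" for Q
    proof -
      have "Q \<in> sets S"
        unfolding S(2) using Q by (rule sigma_sets.Basic)
      moreover obtain A m where "Q = A \<times> {m}" "A \<in> sets N"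
        using Q by auto
      ultimately show ?thesis
        by (simp only: emeasure_distr[OF X] emeasure_distr[OF Y] emeasure_eq_measure X_eq Y_eq)
    qed
    show "emeasure (distr M S X) (space N \<times> {i}) \<noteq> \<infinity>" for i
      using finite_measure.emeasure_finite[OF finite_measure_distr[OF X]] by simp
    show "Int_stable {A \<times> {m :: nat} | A m. A \<in> sets N}"
      by (rule Int_stable_pair_singleton)
    show "{A \<times> {m :: nat} | A m. A \<in> sets N} \<subseteq> Pow (space S)"
      unfolding S(1) by (auto dest: sets.sets_into_space)
    show "range (\<lambda>i. space N \<times> {i}) \<subseteq> {A \<times> {m :: nat} | A m. A \<in> sets N}"
      by auto
    show "(\<Union>i. space N \<times> {i}) = space S"
      unfolding S(1) by auto
  qed (simp_all only: sets_distr S(2))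
  ultimately show "indep_var S X S Y \<and> distr M S X = distr M S Y" ..
qed

lemma preserves_AE:
  assumes "preserves M f" "AE x in M. P x"
  shows "AE x in M. P (f x)"
proof (rule AE_distrD[where f = f and P = P])
  show "f \<in> measurable M M"
    using assms(1) by (simp add: preserves_def)
  have "distr M M f = M"
    using assms(1) by (simp add: preserves_def)
  then show "AE x in distr M M f. P x"
    using assms(2) by (simp only:)
qed

lemma preserves_prob:
  assumes "preserves M f" "A \<in> events"
  shows "prob (f -` A \<inter> space M) = prob A"
  using assms measure_distr[of f M M A] by (simp add: preserves_def)

end

section \<open>The sigma-fields of a noise\<close>

context noise
begin

lemma shift_measurable: "\<Delta> h \<in> measurable M M"
  using shift_preserves by (simp add: preserves_def)

lemma shift_space: "\<omega> \<in> space M \<Longrightarrow> \<Delta> h \<omega> \<in> space M"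
  using measurable_space[OF shift_measurable] .

lemma field_Pow: "m \<le> n \<Longrightarrow> F m n \<subseteq> Pow (space M)"
  using field_sub sets.space_closed by blast

text \<open>The join of two adjacent fields contains each of them; the interval is enlarged at one
  end at a time.\<close>

lemma field_mono:
  assumes "l' \<le> l" "l \<le> m" "m \<le> m'"
  shows "F l m \<subseteq> F l' m'"
proof -
  have "F l m \<subseteq> F l' m"
    using field_join[of l' l m] assms by auto
  also have "\<dots> \<subseteq> F l' m'"
    using field_join[of l' m m'] assms by auto
  finally show ?thesis .
qed

lemma
  assumes "m \<le> n"
  shows field_Int: "A \<in> F m n \<Longrightarrow> B \<in> F m n \<Longrightarrow> A \<inter> B \<in> F m n"
    and field_top: "space M \<in> F m n"
    and field_empty: "{} \<in> F m n"
proof -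
  interpret field: sigma_algebra "space M" "F m n"
    using assms by (rule field_sigma_algebra)
  show "A \<in> F m n \<Longrightarrow> B \<in> F m n \<Longrightarrow> A \<inter> B \<in> F m n" "space M \<in> F m n" "{} \<in> F m n"
    by auto
qed

lemma space_field_space [simp]: "space (field_space M F n) = space M"
  unfolding field_space_def by (simp add: space_measure_of field_Pow)

lemma sets_field_space [simp]: "sets (field_space M F n) = F 0 (int n)"
  unfolding field_space_def
  by (simp add: sets_measure_of field_Pow sigma_algebra.sigma_sets_eq field_sigma_algebra)

lemma fields_Pow: "(\<Union>n::nat. F 0 (int n)) \<subseteq> Pow (space M)"
  by (intro UN_least field_Pow) simp

lemma space_field_space_inf [simp]: "space (field_space_inf M F) = space M"
  unfolding field_space_inf_def by (simp add: space_measure_of fields_Pow)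

lemma sets_field_space_inf:
  "sets (field_space_inf M F) = sigma_sets (space M) (\<Union>n::nat. F 0 (int n))"
  unfolding field_space_inf_def by (simp add: sets_measure_of fields_Pow)

lemma field_sub_inf: "F 0 (int n) \<subseteq> sets (field_space_inf M F)"
  unfolding sets_field_space_inf by auto

lemma field_inf_sub: "sets (field_space_inf M F) \<subseteq> events"
  unfolding sets_field_space_inf by (intro sets.sigma_sets_subset UN_least field_sub) simp

lemma measurable_field_space_inf:
  assumes "f \<in> measurable N M"
  shows "f \<in> measurable N (field_space_inf M F)"
  using assms field_inf_sub unfolding measurable_def by auto

end

section \<open>Independence of the reversed past and the future\<close>

context symmetric_noise
begin

lemma reversal_measurable: "r \<in> measurable M M"
  using reversal_preserves by (simp add: preserves_def)

lemma reversal_space: "\<omega> \<in> space M \<Longrightarrow> r \<omega> \<in> space M"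
  using measurable_space[OF reversal_measurable] .

text \<open>Reversal pulls the future field back into the past field, generated by all
  \<open>F (- int n) 0\<close>. Past and future are each generated by an increasing union of fields,
  hence by a pi-system, and the noise axiom gives independence of these unions.\<close>

lemma indep_reversed_field:
  assumes A: "A \<in> sets (field_space_inf M F)" and B: "B \<in> sets (field_space_inf M F)"
  shows "prob ((r -` A \<inter> space M) \<inter> B) = prob A * prob B"
proof -
  define P where "P = (\<Union>n::nat. F (- int n) 0)"
  define Q where "Q = (\<Union>n::nat. F 0 (int n))"
  have P_Pow: "P \<subseteq> Pow (space M)"
    unfolding P_def by (intro UN_least field_Pow) simp
  have "indep_set P Q"
  proof (rule indep_setI)
    fix a b assume "a \<in> P" "b \<in> Q"
    then obtain i j :: nat where ij: "a \<in> F (- int i) 0" "b \<in> F 0 (int j)"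
      unfolding P_def Q_def by blast
    show "prob (a \<inter> b) = prob a * prob b"
      by (rule indep_setD[OF field_indep ij]) simp_all
  next
    show "P \<subseteq> events" "Q \<subseteq> events"
      unfolding P_def Q_def by (intro UN_least field_sub; simp)+
  qed
  moreover have "Int_stable P"
  proof (rule Int_stableI)
    fix a b assume "a \<in> P" "b \<in> P"
    then obtain i j :: nat where ij: "a \<in> F (- int i) 0" "b \<in> F (- int j) 0"
      unfolding P_def by blast
    define k where "k = max i j"
    have "a \<in> F (- int k) 0"
      by (rule subsetD[OF field_mono ij(1)]) (simp_all add: k_def)
    moreover have "b \<in> F (- int k) 0"
      by (rule subsetD[OF field_mono ij(2)]) (simp_all add: k_def)
    ultimately have "a \<inter> b \<in> F (- int k) 0"
      by (rule field_Int[rotated]) simp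
    then show "a \<inter> b \<in> P"
      unfolding P_def by blast
  qed
  moreover have "Int_stable Q"
  proof (rule Int_stableI)
    fix a b assume "a \<in> Q" "b \<in> Q"
    then obtain i j :: nat where ij: "a \<in> F 0 (int i)" "b \<in> F 0 (int j)"
      unfolding Q_def by blast
    define k where "k = max i j"
    have "a \<in> F 0 (int k)"
      by (rule subsetD[OF field_mono ij(1)]) (simp_all add: k_def)
    moreover have "b \<in> F 0 (int k)"
      by (rule subsetD[OF field_mono ij(2)]) (simp_all add: k_def)
    ultimately have "a \<inter> b \<in> F 0 (int k)"
      by (rule field_Int[rotated]) simp
    then show "a \<inter> b \<in> Q"
      unfolding Q_def by blast
  qed
  ultimately have indep: "indep_set (sigma_sets (space M) P) (sigma_sets (space M) Q)"
    by (rule indep_set_sigma_sets)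
  \<comment> \<open>The reversal is viewed as a map from the past field to the future field, so that
    checking the generators settles all of \<open>A\<close>.\<close>
  have "r \<in> measurable (sigma (space M) P) (field_space_inf M F)"
    unfolding field_space_inf_def
  proof (rule measurable_measure_of[OF fields_Pow])
    show "r \<in> space (sigma (space M) P) \<rightarrow> space M"
      using P_Pow reversal_space by (simp add: space_measure_of)
    fix y assume "y \<in> (\<Union>n::nat. F 0 (int n))"
    then obtain n :: nat where y: "y \<in> F 0 (int n)" by blast
    have "r -` y \<inter> space M \<in> preimage_field M r (F 0 (int n))"
      unfolding preimage_field_def using y by blast
    also have "preimage_field M r (F 0 (int n)) = F (- int n) 0"
      using reversal_field[of 0 "int n"] by simp
    also have "\<dots> \<subseteq> P"
      unfolding P_def by blast
    finally show "r -` y \<inter> space (sigma (space M) P) \<in> sets (sigma (space M) P)"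
      using P_Pow by (simp add: space_measure_of sets_measure_of sigma_sets.Basic)
  qed
  from measurable_sets[OF this A] have "r -` A \<inter> space M \<in> sigma_sets (space M) P"
    using P_Pow by (simp add: space_measure_of sets_measure_of)
  then have "prob ((r -` A \<inter> space M) \<inter> B) = prob (r -` A \<inter> space M) * prob B"
    using B unfolding sets_field_space_inf Q_def[symmetric] by (rule indep_setD[OF indep])
  then show ?thesis
    using A field_inf_sub preserves_prob[OF reversal_preserves] by auto
qed

text \<open>The point \<open>r (\<Delta> m \<omega>)\<close> carries the noise before time \<open>m\<close>, run backwards from \<open>m\<close>, and
  \<open>\<Delta> m \<omega>\<close> carries the noise after time \<open>m\<close>.\<close>

definition two_sided :: "nat \<Rightarrow> 'a set \<Rightarrow> 'a set \<Rightarrow> 'a set" where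
  "two_sided m A B = {\<omega> \<in> space M. r (\<Delta> (int m) \<omega>) \<in> A \<and> \<Delta> (int m) \<omega> \<in> B}"

lemma two_sided_Int: "two_sided m A B \<inter> two_sided m A' B' = two_sided m (A \<inter> A') (B \<inter> B')"
  by (auto simp: two_sided_def)

lemma two_sided_space: "two_sided m (space M) (space M) = space M"
  by (auto simp: two_sided_def shift_space reversal_space)

lemma two_sided_eq_vimage:
  "two_sided m A B = \<Delta> (int m) -` ((r -` A \<inter> space M) \<inter> B) \<inter> space M"
  by (auto simp: two_sided_def shift_space)

lemma two_sided_events: "A \<in> events \<Longrightarrow> B \<in> events \<Longrightarrow> two_sided m A B \<in> events"
  unfolding two_sided_eq_vimage
  by (intro measurable_sets[OF shift_measurable] sets.Int measurable_sets[OF reversal_measurable])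

text \<open>A two-sided event at \<open>m\<close> is the shift by \<open>m\<close> of one at 0, so
  shift invariance reduces the claim to independence at time 0.\<close>

lemma prob_two_sided:
  assumes A: "A \<in> sets (field_space_inf M F)" and B: "B \<in> sets (field_space_inf M F)"
  shows "prob (two_sided m A B) = prob A * prob B"
proof -
  have "(r -` A \<inter> space M) \<inter> B \<in> events"
    using A B field_inf_sub by (auto intro: measurable_sets[OF reversal_measurable])
  then show ?thesis
    unfolding two_sided_eq_vimage
    by (simp only: preserves_prob[OF shift_preserves] indep_reversed_field[OF A B])
qed

text \<open>\<open>F 0 (int (m + n))\<close> is the join of the fields before and after time
  \<open>m\<close>, and each of these consists of two-sided events with one side equal to
  \<open>space M\<close>.\<close>

lemma field_subset_two_sided:
  "F 0 (int (m + n)) \<subseteq> sigma_sets (space M)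
    {two_sided m A B | A B. A \<in> F 0 (int m) \<and> B \<in> F 0 (int n)}"
    (is "_ \<subseteq> sigma_sets _ ?G")
proof -
  have "F 0 (int m) \<subseteq> ?G"
  proof
    fix a assume "a \<in> F 0 (int m)"
    \<comment> \<open>The interval from 0 to \<open>m\<close> is reached from itself in two
      pullbacks: the reversal gives the one from \<open>-m\<close> to 0, and the shift by
      \<open>m\<close> moves it back.\<close>
    then have "a \<in> preimage_field M (\<Delta> (int m)) (F (- int m) 0)"
      using field_shift[of "- int m" 0 "int m"] by simp
    then obtain b where b: "b \<in> F (- int m) 0" "a = \<Delta> (int m) -` b \<inter> space M"
      unfolding preimage_field_def by blast
    then have "b \<in> preimage_field M r (F 0 (int m))"
      using reversal_field[of 0 "int m"] by simp
    then obtain A where A: "A \<in> F 0 (int m)" "b = r -` A \<inter> space M"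
      unfolding preimage_field_def by blast
    then have "a = two_sided m A (space M)"
      using b by (auto simp: two_sided_def shift_space)
    then show "a \<in> ?G" using A field_top[of 0 "int n"] by auto
  qed
  moreover have "F (int m) (int (m + n)) \<subseteq> ?G"
  proof
    fix b assume "b \<in> F (int m) (int (m + n))"
    then have "b \<in> preimage_field M (\<Delta> (int m)) (F 0 (int n))"
      using field_shift[of 0 "int n" "int m"] by (simp add: add.commute)
    then obtain B where B: "B \<in> F 0 (int n)" "b = \<Delta> (int m) -` B \<inter> space M"
      unfolding preimage_field_def by blast
    then have "b = two_sided m (space M) B"
      by (auto simp: two_sided_def shift_space reversal_space)
    then show "b \<in> ?G" using B field_top[of 0 "int m"] by auto
  qed
  ultimately have "sigma_sets (space M) (F 0 (int m) \<union> F (int m) (int (m + n))) \<subseteq>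
      sigma_sets (space M) ?G"
    by (intro sigma_sets_mono') auto
  then show ?thesis using field_join[of 0 "int m" "int (m + n)"] by simp
qed

text \<open>The product on the right is the probability of
  \<open>two_sided m Z Z' \<inter> two_sided m A B\<close>, so the condition compares two events on
  all two-sided test events. For the converse, sides in \<open>F 0 (int m)\<close> and
  \<open>F 0 (int n)\<close> suffice, as these test events generate a sigma-field containing both
  events.\<close>

lemma events_eq_two_sided_iff:
  assumes E: "E \<in> F 0 (int (m + n))" and Z: "Z \<in> F 0 (int m)" and Z': "Z' \<in> F 0 (int n)"
  shows "events_eq_as M E (two_sided m Z Z') \<longleftrightarrow>
    (\<forall>A\<in>sets (field_space_inf M F). \<forall>B\<in>sets (field_space_inf M F).
      prob (E \<inter> two_sided m A B) = prob (A \<inter> Z) * prob (B \<inter> Z'))"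
proof -
  let ?C = "two_sided m Z Z'"
  have Zs: "Z \<in> sets (field_space_inf M F)" "Z' \<in> sets (field_space_inf M F)"
    using Z Z' field_sub_inf by auto
  have EC: "E \<in> events" "?C \<in> events"
    using E field_sub[of 0 "int (m + n)"] Zs field_inf_sub by (auto intro: two_sided_events)
  have C: "prob (?C \<inter> two_sided m A B) = prob (A \<inter> Z) * prob (B \<inter> Z')"
    if "A \<in> sets (field_space_inf M F)" "B \<in> sets (field_space_inf M F)" for A B
    using that Zs by (simp add: two_sided_Int prob_two_sided Int_commute sets.Int)
  show ?thesis
  proof
    assume "events_eq_as M E ?C"
    then have "AE \<omega> in M. \<omega> \<notin> (E - ?C) \<union> (?C - E)"
      unfolding events_eq_as_def by (rule AE_not_in)
    then have ae: "AE \<omega> in M. \<omega> \<in> E \<longleftrightarrow> \<omega> \<in> ?C" by (rule AE_mp) auto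
    have "prob (E \<inter> two_sided m A B) = prob (?C \<inter> two_sided m A B)"
      if "A \<in> sets (field_space_inf M F)" "B \<in> sets (field_space_inf M F)" for A B
    proof (rule measure_eq_AE)
      show "AE \<omega> in M. \<omega> \<in> E \<inter> two_sided m A B \<longleftrightarrow> \<omega> \<in> ?C \<inter> two_sided m A B"
        using ae by (rule AE_mp) auto
      show "E \<inter> two_sided m A B \<in> events" "?C \<inter> two_sided m A B \<in> events"
        using that field_inf_sub EC by (auto intro!: two_sided_events sets.Int)
    qed
    then show "\<forall>A\<in>sets (field_space_inf M F). \<forall>B\<in>sets (field_space_inf M F).
        prob (E \<inter> two_sided m A B) = prob (A \<inter> Z) * prob (B \<inter> Z')"
      using C by auto
  next
    assume *: "\<forall>A\<in>sets (field_space_inf M F). \<forall>B\<in>sets (field_space_inf M F).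
        prob (E \<inter> two_sided m A B) = prob (A \<inter> Z) * prob (B \<inter> Z')"
    let ?G = "{two_sided m A B | A B. A \<in> F 0 (int m) \<and> B \<in> F 0 (int n)}"
    show "events_eq_as M E ?C"
      unfolding events_eq_as_def
    proof (rule symdiff_null_sets_if_generator[of ?G])
      show "?G \<subseteq> events"
        using field_sub[of 0 "int m"] field_sub[of 0 "int n"] by (auto intro!: two_sided_events)
      show "Int_stable ?G"
      proof (rule Int_stableI, clarify)
        fix A B A' B'
        assume "A \<in> F 0 (int m)" "B \<in> F 0 (int n)" "A' \<in> F 0 (int m)" "B' \<in> F 0 (int n)"
        then show "\<exists>A'' B''. two_sided m A B \<inter> two_sided m A' B' = two_sided m A'' B'' \<and>
            A'' \<in> F 0 (int m) \<and> B'' \<in> F 0 (int n)"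
          by (intro exI[of _ "A \<inter> A'"] exI[of _ "B \<inter> B'"]) (simp add: two_sided_Int field_Int)
      qed
      show "E \<in> sigma_sets (space M) ?G"
        using E field_subset_two_sided by blast
      show "?C \<in> sigma_sets (space M) ?G"
        using Z Z' by (intro sigma_sets.Basic) auto
      fix D assume "D \<in> insert (space M) ?G"
      \<comment> \<open>The whole space is the two-sided event with both sides
        \<open>space M\<close>.\<close>
      then have "D \<in> ?G"
        using two_sided_space[of m] field_top[of 0 "int m"] field_top[of 0 "int n"] by force
      then obtain A B where "D = two_sided m A B" "A \<in> F 0 (int m)" "B \<in> F 0 (int n)" by auto
      then show "prob (E \<inter> D) = prob (?C \<inter> D)"
        using * C field_sub_inf by (metis subsetD)
    qed
  qed
qed

end

section \<open>Splitting at a geometric time\<close>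

locale noise_times = symmetric_noise M F \<Delta> r
  for M :: "'a measure" and F :: "int \<Rightarrow> int \<Rightarrow> 'a set set" and \<Delta> :: "int \<Rightarrow> 'a \<Rightarrow> 'a"
    and r :: "'a \<Rightarrow> 'a" +
  fixes \<tau> :: "nat \<Rightarrow> 'a \<Rightarrow> nat"
  assumes times: "\<tau> n \<in> measurable (field_space M F n) (count_space {0..n})"
begin

lemma times_le: "\<omega> \<in> space M \<Longrightarrow> \<tau> n \<omega> \<le> n"
  using measurable_space[OF times[of n], of \<omega>] by simp

lemma times_field: "{\<omega> \<in> space M. \<tau> n \<omega> = m} \<in> F 0 (int n)"
proof (cases "m \<le> n")
  case True
  then have "\<tau> n -` {m} \<inter> space M \<in> F 0 (int n)"
    using measurable_sets[OF times[of n], of "{m}"] by simp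
  then show ?thesis by (simp add: vimage_def Int_def conj_commute)
next
  case False
  \<comment> \<open>Measurability into \<open>count_space {0..n}\<close> speaks only of values up to
    \<open>n\<close>; larger values are never taken.\<close>
  then have "{\<omega> \<in> space M. \<tau> n \<omega> = m} = {}" using times_le by fastforce
  then show ?thesis
    by (simp only: field_empty[of 0 "int n"] of_nat_0_le_iff)
qed

lemma times_measurable: "\<tau> n \<in> measurable M (count_space UNIV)"
proof (subst measurable_count_space_eq2_countable, intro conjI ballI)
  fix m
  have "\<tau> n -` {m} \<inter> space M = {\<omega> \<in> space M. \<tau> n \<omega> = m}" by auto
  then show "\<tau> n -` {m} \<inter> space M \<in> events"
    using times_field field_sub[of 0 "int n"] by auto
qed auto

abbreviation zero_event :: "nat \<Rightarrow> 'a set" where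
  "zero_event n \<equiv> {\<omega> \<in> space M. \<tau> n \<omega> = 0}"

lemma splitting_condition_two_sided:
  "((r \<circ> \<Delta> (int m)) -` zero_event m \<inter> space M) \<inter> (\<Delta> (int m) -` zero_event n \<inter> space M) =
    two_sided m (zero_event m) (zero_event n)"
  by (auto simp: two_sided_def)

lemma prob_space_enlargement: "prob_space (geometric_enlargement M p)"
  unfolding geometric_enlargement_def
  by (intro prob_space_pair prob_space_axioms measure_pmf.prob_space_axioms)

lemma measure_enlargement:
  assumes p: "0 < p" "p < 1" and "A \<in> events"
  shows "measure (geometric_enlargement M p) (A \<times> {k}) = p * (1 - p) ^ k * prob A"
proof -
  have "emeasure (geometric_enlargement M p) (A \<times> {k}) =
      emeasure M A * emeasure (measure_pmf (geometric_pmf p)) {k}"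
    unfolding geometric_enlargement_def
    using assms by (intro measure_pmf.emeasure_pair_measure_Times) auto
  then have "measure (geometric_enlargement M p) (A \<times> {k}) = prob A * pmf (geometric_pmf p) k"
    by (simp add: measure_def enn2real_mult emeasure_pmf_single)
  then show ?thesis using p by simp
qed

text \<open>Both maps evaluate measurable families at a random index with countably many values.
  Measurability into \<open>M\<close> then passes to the coarser future field.\<close>

lemma split_measurable:
  shows pre_split_measurable: "pre_split \<Delta> r \<tau> \<in>
      measurable (geometric_enlargement M p) (field_space_inf M F \<Otimes>\<^sub>M count_space UNIV)"
    and post_split_measurable: "post_split \<Delta> \<tau> \<in>
      measurable (geometric_enlargement M p) (field_space_inf M F \<Otimes>\<^sub>M count_space UNIV)"
proof -
  let ?P = "geometric_enlargement M p"
  have fst: "fst \<in> measurable ?P M"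
    unfolding geometric_enlargement_def by simp
  have snd: "snd \<in> measurable ?P (count_space UNIV)"
    unfolding geometric_enlargement_def by (simp cong: measurable_cong_sets)
  have \<tau>: "(\<lambda>x. \<tau> (snd x) (fst x)) \<in> measurable ?P (count_space UNIV)"
    by (rule measurable_compose_countable[OF measurable_compose[OF fst times_measurable] snd])
  have \<Delta>: "(\<lambda>x. \<Delta> (int (\<tau> (snd x) (fst x))) (fst x)) \<in> measurable ?P M"
    by (rule measurable_compose_countable[OF measurable_compose[OF fst shift_measurable] \<tau>])
  have "(\<lambda>x. snd x - \<tau> (snd x) (fst x)) \<in> measurable ?P (count_space UNIV)"
    using snd \<tau> by measurable
  then show "post_split \<Delta> \<tau> \<in> measurable ?P (field_space_inf M F \<Otimes>\<^sub>M count_space UNIV)"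
    unfolding post_split_def case_prod_beta
    by (intro measurable_Pair measurable_field_space_inf \<Delta>)
  show "pre_split \<Delta> r \<tau> \<in> measurable ?P (field_space_inf M F \<Otimes>\<^sub>M count_space UNIV)"
    unfolding pre_split_def case_prod_beta
    by (intro measurable_Pair measurable_field_space_inf
        measurable_compose[OF \<Delta> reversal_measurable] \<tau>)
qed

text \<open>By \<open>times_le\<close> the subtraction is exact, so
  \<open>\<tau> k \<omega> = m\<close> and \<open>k - \<tau> k \<omega> = n\<close> force
  \<open>k = m + n\<close>: the geometric time is determined by the two parts.\<close>

lemma split_vimage:
  "(pre_split \<Delta> r \<tau> -` (A \<times> {m}) \<inter> space (geometric_enlargement M p)) \<inter>
    (post_split \<Delta> \<tau> -` (B \<times> {n}) \<inter> space (geometric_enlargement M p)) =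
    ({\<omega> \<in> space M. \<tau> (m + n) \<omega> = m} \<inter> two_sided m A B) \<times> {m + n}"
  using times_le
  by (auto simp: pre_split_def post_split_def geometric_enlargement_def space_pair_measure
      two_sided_def)

text \<open>Given the product formula with factors \<open>f\<close>, the case \<open>m = 0\<close>, \<open>A = space M\<close>
  determines \<open>f B n\<close> up to the constant \<open>f (space M) 0\<close>, which is \<open>sqrt p\<close>.\<close>

lemma splitting_at_iff:
  fixes p :: real
  assumes p: "0 < p" "p < 1"
  defines "P \<equiv> geometric_enlargement M p"
    and "S \<equiv> field_space_inf M F \<Otimes>\<^sub>M count_space UNIV"
  shows "prob_space.indep_var P S (pre_split \<Delta> r \<tau>) S (post_split \<Delta> \<tau>) \<and>
      distr P S (pre_split \<Delta> r \<tau>) = distr P S (post_split \<Delta> \<tau>) \<longleftrightarrow>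
    (\<forall>m n. \<forall>A\<in>sets (field_space_inf M F). \<forall>B\<in>sets (field_space_inf M F).
      prob ({\<omega> \<in> space M. \<tau> (m + n) \<omega> = m} \<inter> two_sided m A B) =
      prob (A \<inter> zero_event m) * prob (B \<inter> zero_event n))"
    (is "?split \<longleftrightarrow> ?rhs")
proof -
  let ?I = "sets (field_space_inf M F)"
  let ?J = "\<lambda>A B m n. prob ({\<omega> \<in> space M. \<tau> (m + n) \<omega> = m} \<inter> two_sided m A B)"
  interpret P: prob_space P
    unfolding P_def by (rule prob_space_enlargement)
  have joint: "P.prob ((pre_split \<Delta> r \<tau> -` (A \<times> {m}) \<inter> space P) \<inter>
      (post_split \<Delta> \<tau> -` (B \<times> {n}) \<inter> space P)) = p * (1 - p) ^ (m + n) * ?J A B m n"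
    if "A \<in> ?I" "B \<in> ?I" for A B m n
    unfolding P_def split_vimage
    using that field_inf_sub times_field[of "m + n" m] field_sub[of 0 "int (m + n)"]
    by (intro measure_enlargement p sets.Int two_sided_events) auto
  have split: "?split \<longleftrightarrow> (\<exists>f. (\<forall>A\<in>?I. \<forall>m. 0 \<le> f A m) \<and> (\<forall>A\<in>?I. \<forall>B\<in>?I. \<forall>m n.
      P.prob ((pre_split \<Delta> r \<tau> -` (A \<times> {m}) \<inter> space P) \<inter>
        (post_split \<Delta> \<tau> -` (B \<times> {n}) \<inter> space P)) = f A m * f B n))"
    unfolding S_def P_def
    by (rule prob_space.indep_identically_distributed_iff[OF prob_space_enlargement
        pre_split_measurable post_split_measurable])
  show ?thesis
    unfolding split
  proof
    assume "\<exists>f. (\<forall>A\<in>?I. \<forall>m. 0 \<le> f A m) \<and> (\<forall>A\<in>?I. \<forall>B\<in>?I. \<forall>m n.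
      P.prob ((pre_split \<Delta> r \<tau> -` (A \<times> {m}) \<inter> space P) \<inter>
        (post_split \<Delta> \<tau> -` (B \<times> {n}) \<inter> space P)) = f A m * f B n)"
    then obtain f where "\<forall>A\<in>?I. \<forall>B\<in>?I. \<forall>m n.
      P.prob ((pre_split \<Delta> r \<tau> -` (A \<times> {m}) \<inter> space P) \<inter>
        (post_split \<Delta> \<tau> -` (B \<times> {n}) \<inter> space P)) = f A m * f B n"
      by blast
    then have f: "p * (1 - p) ^ (m + n) * ?J A B m n = f A m * f B n"
      if "A \<in> ?I" "B \<in> ?I" for A B m n
      using that by (simp only: joint[OF that, symmetric])
    have top: "space M \<in> ?I"
      using sets.top[of "field_space_inf M F"] by simp
    \<comment> \<open>At \<open>m = 0\<close> the shift is the identity and the reversed side is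
      unrestricted, so only \<open>B\<close> remains of the two-sided event.\<close>
    have J0: "?J (space M) B 0 n = prob (B \<inter> zero_event n)" if "B \<in> ?I" for B n
    proof -
      have "B \<subseteq> space M" using sets.sets_into_space[OF that] by simp
      then have "{\<omega> \<in> space M. \<tau> (0 + n) \<omega> = 0} \<inter> two_sided 0 (space M) B = B \<inter> zero_event n"
        by (auto simp: two_sided_def shift_zero reversal_space)
      then show ?thesis by simp
    qed
    define s where "s = f (space M) 0"
    have "zero_event 0 = space M"
      using times_le[of _ 0] by auto
    \<comment> \<open>As \<open>\<tau> 0\<close> is always 0, the product formula with
      \<open>m = n = 0\<close> and full events has left side \<open>p\<close>.\<close>
    then have s: "p = s * s"
      using f[OF top top, of 0 0] J0[OF top, of 0] by (simp add: s_def prob_space)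
    with p have "s \<noteq> 0" by auto
    have f_eq: "f B n = s * (1 - p) ^ n * prob (B \<inter> zero_event n)" if "B \<in> ?I" for B n
    proof -
      have "s * f B n = s * s * (1 - p) ^ n * prob (B \<inter> zero_event n)"
        using f[OF top that, of 0 n] unfolding J0[OF that] by (simp add: s_def[symmetric] s[symmetric])
      then show ?thesis using \<open>s \<noteq> 0\<close> by simp
    qed
    show ?rhs
    proof (intro ballI allI)
      fix A B m n assume AB: "A \<in> ?I" "B \<in> ?I"
      have "p * (1 - p) ^ (m + n) * ?J A B m n =
          s * s * (1 - p) ^ (m + n) * (prob (A \<inter> zero_event m) * prob (B \<inter> zero_event n))"
        unfolding f[OF AB] f_eq[OF AB(1)] f_eq[OF AB(2)] by (simp add: power_add)
      then show "?J A B m n = prob (A \<inter> zero_event m) * prob (B \<inter> zero_event n)"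
        using p unfolding s[symmetric] by simp
    qed
  next
    assume ?rhs
    \<comment> \<open>The weight \<open>p * (1 - p) ^ (m + n)\<close> is shared symmetrically, with
      \<open>sqrt p\<close> going to each part, so that both parts have the same factor.\<close>
    then have "P.prob ((pre_split \<Delta> r \<tau> -` (A \<times> {m}) \<inter> space P) \<inter>
        (post_split \<Delta> \<tau> -` (B \<times> {n}) \<inter> space P)) =
        (sqrt p * (1 - p) ^ m * prob (A \<inter> zero_event m)) *
        (sqrt p * (1 - p) ^ n * prob (B \<inter> zero_event n))"
      if "A \<in> ?I" "B \<in> ?I" for A B m n
      using that p unfolding joint[OF that] by (simp add: power_add)
    then show "\<exists>f. (\<forall>A\<in>?I. \<forall>m. 0 \<le> f A m) \<and> (\<forall>A\<in>?I. \<forall>B\<in>?I. \<forall>m n.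
      P.prob ((pre_split \<Delta> r \<tau> -` (A \<times> {m}) \<inter> space P) \<inter>
        (post_split \<Delta> \<tau> -` (B \<times> {n}) \<inter> space P)) = f A m * f B n)"
      using p
      by (intro exI[of _ "\<lambda>A m. sqrt p * (1 - p) ^ m * prob (A \<inter> zero_event m)"] conjI ballI allI)
        simp_all
  qed
qed

theorem symmetric_splitting_iff:
  "symmetric_splitting M F \<Delta> r \<tau> \<longleftrightarrow>
    (\<forall>m n. events_eq_as M {\<omega> \<in> space M. \<tau> (m + n) \<omega> = m}
      (two_sided m (zero_event m) (zero_event n)))"
proof -
  let ?product = "\<forall>m n. \<forall>A\<in>sets (field_space_inf M F). \<forall>B\<in>sets (field_space_inf M F).
      prob ({\<omega> \<in> space M. \<tau> (m + n) \<omega> = m} \<inter> two_sided m A B) =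
      prob (A \<inter> zero_event m) * prob (B \<inter> zero_event n)"
  have "symmetric_splitting M F \<Delta> r \<tau> \<longleftrightarrow> (\<forall>p\<in>{0<..<1 :: real}. ?product)"
    unfolding symmetric_splitting_def Let_def
    by (rule ball_cong[OF refl], rule splitting_at_iff) simp_all
  also have "\<dots> \<longleftrightarrow> ?product"
  proof
    assume all: "\<forall>p\<in>{0<..<1 :: real}. ?product"
    \<comment> \<open>The product formula does not involve \<open>p\<close>, so a single value in
      the open interval yields it.\<close>
    show ?product by (rule bspec[OF all, of "1 / 2"]) simp
  qed (rule ballI)
  finally show ?thesis
    unfolding events_eq_two_sided_iff[OF times_field times_field times_field] .
qed

text \<open>Reversing the path from time \<open>n\<close> exchanges its two parts at the splitting
  time. The condition for splitting into lengths \<open>m\<close> and \<open>k\<close> becomes the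
  one for \<open>k\<close> and \<open>m\<close>, so the reversed path splits at
  \<open>k = n - m\<close>.\<close>

lemma symmetric_splitting_reversal:
  assumes "symmetric_splitting M F \<Delta> r \<tau>"
  shows "AE \<omega> in M. \<tau> n \<omega> + \<tau> n ((r \<circ> \<Delta> (int n)) \<omega>) = n"
proof -
  define Q where "Q \<omega> \<longleftrightarrow> (\<forall>m k. \<omega> \<in> {\<omega> \<in> space M. \<tau> (m + k) \<omega> = m} \<longleftrightarrow>
    \<omega> \<in> two_sided m (zero_event m) (zero_event k))" for \<omega>
  have Q: "AE \<omega> in M. Q \<omega>"
    unfolding Q_def AE_all_countable
  proof (intro allI)
    fix m k
    have "AE \<omega> in M. \<omega> \<notin>
        ({\<omega> \<in> space M. \<tau> (m + k) \<omega> = m} - two_sided m (zero_event m) (zero_event k)) \<union>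
        (two_sided m (zero_event m) (zero_event k) - {\<omega> \<in> space M. \<tau> (m + k) \<omega> = m})"
      using assms unfolding symmetric_splitting_iff events_eq_as_def by (intro AE_not_in) simp
    then show "AE \<omega> in M. \<omega> \<in> {\<omega> \<in> space M. \<tau> (m + k) \<omega> = m} \<longleftrightarrow>
        \<omega> \<in> two_sided m (zero_event m) (zero_event k)"
      by (rule AE_mp) auto
  qed
  \<comment> \<open>The criterion is used in one direction at \<open>\<omega>\<close> and in the
    other at the reversed path; measure preservation makes it hold almost surely at both.\<close>
  then have "AE \<omega> in M. Q (r (\<Delta> (int n) \<omega>))"
    by (intro preserves_AE[OF shift_preserves] preserves_AE[OF reversal_preserves])
  with Q AE_space show ?thesis
  proof eventually_elim
    case (elim \<omega>)
    define m where "m = \<tau> n \<omega>"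
    define k where "k = n - m"
    define \<omega>' where "\<omega>' = r (\<Delta> (int n) \<omega>)"
    have n: "m + k = n"
      using times_le[OF elim(2)] by (simp add: m_def k_def)
    have \<omega>': "\<omega>' \<in> space M"
      unfolding \<omega>'_def by (intro reversal_space shift_space elim)
    have "\<Delta> (int k) \<omega>' = r (\<Delta> (- int k) (\<Delta> (int n) \<omega>))"
      unfolding \<omega>'_def using reversal_shift[OF shift_space[OF elim(2)], of "- int k" "int n"]
      by simp
    also have "\<dots> = r (\<Delta> (int m) \<omega>)"
      using shift_add[OF elim(2), of "- int k" "int n"] by (simp flip: n)
    finally have after: "\<Delta> (int k) \<omega>' = r (\<Delta> (int m) \<omega>)" .
    have "\<tau> (m + k) \<omega> = m"
      unfolding n by (rule m_def[symmetric])
    then have "\<omega> \<in> two_sided m (zero_event m) (zero_event k)"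
      using elim(1,2) unfolding Q_def by simp
    \<comment> \<open>By \<open>after\<close> and the involution,
      \<open>r (\<Delta> (int k) \<omega>')\<close> equals \<open>\<Delta> (int m) \<omega>\<close>,
      so the two sides have changed places.\<close>
    then have "\<omega>' \<in> two_sided k (zero_event k) (zero_event m)"
      using \<omega>' elim(2) by (simp add: two_sided_def after reversal_involution shift_space)
    then have "\<tau> (k + m) \<omega>' = k"
      using elim(3) \<omega>' unfolding \<omega>'_def[symmetric] Q_def by simp
    then have "\<tau> n \<omega>' = k"
      by (simp only: add.commute[of k m] n)
    then show ?case
      by (simp add: n m_def[symmetric] \<omega>'_def[symmetric])
  qed
qed

end

theorem theorem2p6:
  fixes M :: "'a measure"
    and F :: "int \<Rightarrow> int \<Rightarrow> 'a set set"
    and \<Delta> :: "int \<Rightarrow> 'a \<Rightarrow> 'a"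
    and r :: "'a \<Rightarrow> 'a"
    and \<tau> :: "nat \<Rightarrow> 'a \<Rightarrow> nat"
  assumes "symmetric_noise M F \<Delta> r"
    and "\<And>n. \<tau> n \<in> measurable (field_space M F n) (count_space {0..n})"
  shows "(symmetric_splitting M F \<Delta> r \<tau> \<longleftrightarrow>
      (\<forall>m n. events_eq_as M
        {\<omega> \<in> space M. \<tau> (m + n) \<omega> = m}
        (((r \<circ> \<Delta> (int m)) -` {\<omega> \<in> space M. \<tau> m \<omega> = 0} \<inter> space M) \<inter>
         (\<Delta> (int m) -` {\<omega> \<in> space M. \<tau> n \<omega> = 0} \<inter> space M)))) \<and>
    (symmetric_splitting M F \<Delta> r \<tau> \<longrightarrow>
      (\<forall>n. AE \<omega> in M. \<tau> n \<omega> + \<tau> n ((r \<circ> \<Delta> (int n)) \<omega>) = n))"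
proof -
  interpret noise_times M F \<Delta> r \<tau>
    using assms by (intro noise_times.intro noise_times_axioms.intro)
  show ?thesis
    unfolding splitting_condition_two_sided
    by (intro conjI impI allI symmetric_splitting_iff symmetric_splitting_reversal)
qed

end
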